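(* Let $G$ be a group, written additively, of order $n$, and let $D$ be an $(n,k,\lambda)$-difference set in $G$. (a) If $0\notin D$, then $D$ forms a signature set for an $(n,k)$-equiangular frame if and only if $D$ is reversible and $k=\frac{n-\sqrt n}{2}$. (b) If $0\in D$, then $D\setminus\{0\}$ forms a signature set for an $(n,k)$-equiangular frame if and only if $D$ is reversible and $k=\frac{n+\sqrt n}{2}$.
   Context: A subset $D$ of an additively written group $G$ of order $n$ with $|D|=k$ is an $(n,k,\lambda)$-difference set if, for the fixed number $\lambda$, every nonzero element of $G$ can be written as a difference of two elements of $D$ in exactly $\lambda$ ways. $D$ is reversible if $-D=\{-d:d\in D\}=D$. In the claim, the same $k=|D|$ is the dimension parameter of the frame. An $(n,k)$-frame is a Parseval frame $\{f_1,\dots,f_n\}$ for $\mathbb C^k$, i.e. $\sum_{j}|\langle x,f_j\rangle|^2=\|x\|^2$ for all $x\in\mathbb C^k$. It is equiangular if all $f_i\neq 0$ and there is a constant $b$ with $|\langle f_i/\|f_i\|,f_j/\|f_j\|\rangle|=b$ for all $i\ne j$. For $1\le k<n$, put $c_{n,k}=\sqrt{\frac{k(n-k)}{n^2(n-1)}}$. A self-adjoint $n\times n$ matrix $Q$ with $Q_{ii}=0$ and $|Q_{ij}|=1$ for $i\neq j$ is the signature matrix of an $(n,k)$-equiangular frame if there is an equiangular $(n,k)$-frame whose Gram matrix $(\langle f_j,f_i\rangle)_{i,j}$ equals $\frac kn I_n+c_{n,k}Q$. Let $L$ be the left regular representation of $G$: $L(g)e_h=e_{g+h}$ on the vector space with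 basis $\{e_h\}_{h\in G}$, regarded as $n\times n$ permutation matrices. For $S\subseteq G\setminus\{0\}$ and $T=(G\setminus\{0\})\setminus S$, the set $S$ is a signature set for an $(n,k)$-equiangular frame if $Q=\sum_{g\in S}L(g)-\sum_{h\in T}L(h)$ is the signature matrix of an $(n,k)$-equiangular frame.
   Formalization: The formal theorem assumes n ≥ 3; the claim fails for n = 2 (D = {1} in Z_2 is a (2,1,0)-difference set and a signature set for a (2,1)-equiangular frame, but 1 ≠ (2−√2)/2; likewise D = {0}), and for n = 1 no k with 1 ≤ k < n exists. *)

theory Defs
  imports "HOL-Analysis.Analysis" "Jordan_Normal_Form.Matrix"
begin

text \<open>
  Two kinds of vectors and matrices occur. Elements of $C^k$, where \<open>k\<close> is a term and may depend on
  other data, are members of \<open>carrier_vec k\<close> (type \<open>complex Matrix.vec\<close>). Square matrices whose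
  rows and columns are indexed by the elements of a finite type \<open>'i\<close>, for instance the elements of
  a finite group, have type \<open>'i sq_matrix\<close>. The inner product \<open>x \<bullet>c y\<close> is linear in \<open>x\<close> and
  conjugate linear in \<open>y\<close>.
\<close>

type_synonym 'i sq_matrix = "complex ^ 'i ^ 'i"

definition cvec_norm :: "complex Matrix.vec \<Rightarrow> real" where
  "cvec_norm x = sqrt (Re (x \<bullet>c x))"

text \<open>The vectors of an \<open>(n,k)\<close>-frame are indexed by a type with \<open>n\<close> elements instead of by
  \<open>{1..n}\<close>, so that its Gram matrix can be compared with a matrix indexed by a group.\<close>

definition parseval_frame :: "nat \<Rightarrow> nat \<Rightarrow> ('i::finite \<Rightarrow> complex Matrix.vec) \<Rightarrow> bool" where
  "parseval_frame n k f \<longleftrightarrow>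
     CARD('i) = n \<and> (\<forall>j. f j \<in> carrier_vec k) \<and>
     (\<forall>x\<in>carrier_vec k. (\<Sum>j\<in>UNIV. (cmod (x \<bullet>c f j))\<^sup>2) = (cvec_norm x)\<^sup>2)"

definition normalized :: "complex Matrix.vec \<Rightarrow> complex Matrix.vec" where
  "normalized x = complex_of_real (1 / cvec_norm x) \<cdot>\<^sub>v x"

definition equiangular :: "nat \<Rightarrow> ('i \<Rightarrow> complex Matrix.vec) \<Rightarrow> bool" where
  "equiangular k f \<longleftrightarrow>
     (\<forall>i. f i \<noteq> 0\<^sub>v k) \<and>
     (\<exists>b::real. \<forall>i j. i \<noteq> j \<longrightarrow> cmod (normalized (f i) \<bullet>c normalized (f j)) = b)"

definition equiangular_frame :: "nat \<Rightarrow> nat \<Rightarrow> ('i::finite \<Rightarrow> complex Matrix.vec) \<Rightarrow> bool" where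
  "equiangular_frame n k f \<longleftrightarrow> parseval_frame n k f \<and> equiangular k f"

definition gram_matrix :: "('i::finite \<Rightarrow> complex Matrix.vec) \<Rightarrow> 'i sq_matrix" where
  "gram_matrix f = (\<chi> i j. f j \<bullet>c f i)"

definition frame_const :: "nat \<Rightarrow> nat \<Rightarrow> real" where
  "frame_const n k = sqrt (real k * (real n - real k) / ((real n)\<^sup>2 * (real n - 1)))"

definition self_adjoint :: "'i::finite sq_matrix \<Rightarrow> bool" where
  "self_adjoint Q \<longleftrightarrow> (\<forall>i j. Q $ i $ j = cnj (Q $ j $ i))"

text \<open>The condition \<open>1 \<le> k < n\<close> belongs to the definition: only then is \<open>frame_const n k\<close> the
  intended constant (for \<open>k = n\<close> it vanishes and the Gram matrix would not determine \<open>Q\<close>).\<close>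

definition signature_matrix :: "nat \<Rightarrow> nat \<Rightarrow> 'i::finite sq_matrix \<Rightarrow> bool" where
  "signature_matrix n k Q \<longleftrightarrow>
     1 \<le> k \<and> k < n \<and>
     self_adjoint Q \<and> (\<forall>i. Q $ i $ i = 0) \<and> (\<forall>i j. i \<noteq> j \<longrightarrow> cmod (Q $ i $ j) = 1) \<and>
     (\<exists>f :: 'i \<Rightarrow> complex Matrix.vec.
        equiangular_frame n k f \<and>
        gram_matrix f =
          (real k / real n) *\<^sub>R Finite_Cartesian_Product.mat 1 + frame_const n k *\<^sub>R Q)"

text \<open>A group written additively, not assumed commutative, is a type of class \<open>group_add\<close>.\<close>

definition left_regular :: "'g::{group_add,finite} \<Rightarrow> 'g sq_matrix" where
  "left_regular g = (\<chi> i j. if i = g + j then 1 else 0)"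

lemma left_regular_axis: "left_regular g *v axis h 1 = axis (g + h) 1"
  by (simp add: left_regular_def matrix_vector_mult_def axis_def Finite_Cartesian_Product.vec_eq_iff
      if_distrib[where f = "\<lambda>x. _ * x"] cong: if_cong)

definition signature_set :: "nat \<Rightarrow> nat \<Rightarrow> 'g::{group_add,finite} set \<Rightarrow> bool" where
  "signature_set n k S \<longleftrightarrow>
     S \<subseteq> UNIV - {0} \<and>
     (let T = (UNIV - {0}) - S in
        signature_matrix n k ((\<Sum>g\<in>S. left_regular g) - (\<Sum>h\<in>T. left_regular h)))"

text \<open>With these definitions \<open>{1}\<close> is a \<open>(2,1,0)\<close>-difference set in the group with two elements
  and a signature set for a \<open>(2,1)\<close>-equiangular frame, although \<open>1 \<noteq> (2 - sqrt 2) / 2\<close>;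
  likewise for \<open>{0}\<close> and the empty set of nonzero elements. Groups of order at most \<open>2\<close>
  therefore have to be excluded when signature sets are characterized.\<close>

definition difference_set :: "nat \<Rightarrow> nat \<Rightarrow> nat \<Rightarrow> 'g::{group_add,finite} set \<Rightarrow> bool" where
  "difference_set n k l D \<longleftrightarrow>
     CARD('g) = n \<and> card D = k \<and>
     (\<forall>g. g \<noteq> 0 \<longrightarrow> card {(x, y). x \<in> D \<and> y \<in> D \<and> g = x - y} = l)"

definition reversible :: "'g::group_add set \<Rightarrow> bool" where
  "reversible D \<longleftrightarrow> uminus ` D = D"

end

theory Submission
  imports Defs
begin

text \<open>
  Both parts are one statement. Define a sign function on \<open>G\<close> by \<open>q(0) = 0\<close>, \<open>q = 1\<close> on the nonzero
  elements of \<open>D\<close> and \<open>q = -1\<close> elsewhere, and let \<open>s = 1\<close> if \<open>0 \<notin> D\<close> and \<open>s = -1\<close> otherwise. The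
  matrix built from the signature set \<open>D - {0}\<close> has the entries \<open>Q i j = q(i - j)\<close>, and the claim is
  that it is a signature matrix iff \<open>D\<close> is reversible and \<open>n - 2k = s sqrt n\<close>.

  A matrix is the Gram matrix of a Parseval frame for \<open>C^k\<close> iff it is an orthogonal projection of
  rank \<open>k\<close>. For \<open>(k/n) I + c Q\<close> the trace is automatically \<open>k\<close>, and idempotence is the quadratic
  equation \<open>Q\<^sup>2 = (n-1) I + \<mu> Q\<close> with \<open>\<mu> = (n - 2k) / (n c)\<close>; its diagonal part always holds
  (\<open>signature_matrix_iff\<close>). Self-adjointness of \<open>Q\<close> means that \<open>q\<close> is even, that is, that \<open>D\<close> is
  reversible. Then \<open>Q\<^sup>2\<close> has the autocorrelation of \<open>q\<close> at \<open>i - j\<close> as its entry, and since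
  \<open>q = 2 1\<^sub>D + s \<delta>\<^sub>0 - 1\<close>, the difference set property gives the value \<open>A + 2 s q(g)\<close> at each
  \<open>g \<noteq> 0\<close>, where \<open>A = n - 4(k - l)\<close> (\<open>nonzero_sign_correlation\<close>). So the frame exists iff
  \<open>A + 2 s q(g) = \<mu> q(g)\<close> for all \<open>g \<noteq> 0\<close>.

  If \<open>q\<close> takes both signs, this says \<open>A = 0\<close> and \<open>\<mu> = 2s\<close>. If \<open>q\<close> is constant off \<open>0\<close>, then
  \<open>1 \<le> k < n\<close> leaves only \<open>{0}\<close> and its complement for \<open>D\<close>, and the equation would give \<open>n = 2\<close>.
  The count \<open>l (n - 1) = k (k - 1)\<close> turns \<open>A = 0\<close> into \<open>(n - 2k)\<^sup>2 = n\<close>; then \<open>n c = sqrt n / 2\<close>, so that \<open>\<mu> = 2s\<close> fixes the sign of the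
  square root.
\<close>

(* Below, $ only denotes entries of matrices indexed by a finite type. *)
no_notation vec_index (infixl \<open>$\<close> 100)

section \<open>Parseval frames and their Gram matrices\<close>

lemma of_real_cmod_square: "(complex_of_real (cmod z))\<^sup>2 = z * cnj z"
  using complex_norm_square[of z] by simp

lemma cscalar_prod_coords:
  fixes x y :: "complex Matrix.vec"
  assumes "y \<in> carrier_vec k"
  shows "x \<bullet>c y = (\<Sum>a<k. vec_index x a * cnj (vec_index y a))"
  using assms by (simp add: scalar_prod_def conjugate_complex_def atLeast0LessThan)

lemma cscalar_prod_self:
  assumes "x \<in> carrier_vec k"
  shows "x \<bullet>c x = complex_of_real ((cvec_norm x)\<^sup>2)"
proof -
  have "x \<bullet>c x = complex_of_real (\<Sum>a<k. (cmod (vec_index x a))\<^sup>2)"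
    using assms by (simp add: cscalar_prod_coords of_real_cmod_square)
  moreover have "(\<Sum>a<k. (cmod (vec_index x a))\<^sup>2) \<ge> 0"
    by (rule sum_nonneg) simp
  ultimately show ?thesis
    by (simp add: cvec_norm_def)
qed

lemma cscalar_prod_cnj:
  fixes x y :: "complex Matrix.vec"
  assumes "x \<in> carrier_vec k" "y \<in> carrier_vec k"
  shows "x \<bullet>c y = cnj (y \<bullet>c x)"
  using assms by (simp add: cscalar_prod_coords mult.commute)

text \<open>The Parseval identity at \<open>x\<close>, \<open>y\<close> and \<open>x + y\<close> determines the real part of the polarised
  identity; replacing \<open>y\<close> by \<open>\<i> y\<close> then gives the imaginary part. Taken at two frame vectors, the
  polarised identity says that the Gram matrix is idempotent.\<close>

lemma parseval_polarised_Re: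
  assumes P: "parseval_frame n k f" and x: "x \<in> carrier_vec k" and y: "y \<in> carrier_vec k"
  shows "(\<Sum>m\<in>UNIV. Re ((x \<bullet>c f m) * cnj (y \<bullet>c f m))) = Re (x \<bullet>c y)"
proof -
  have f: "f m \<in> carrier_vec k" for m
    using P by (simp add: parseval_frame_def)
  have sq: "(\<Sum>m\<in>UNIV. (cmod (z \<bullet>c f m))\<^sup>2) = Re (z \<bullet>c z)" if "z \<in> carrier_vec k" for z
    using P that cscalar_prod_self[OF that] by (simp add: parseval_frame_def)
  have expand: "(cmod (u + w))\<^sup>2 = (cmod u)\<^sup>2 + (cmod w)\<^sup>2 + 2 * Re (u * cnj w)" for u w
    by (simp only: cmod_power2) (simp add: power2_eq_square algebra_simps)
  have lin: "(x + y) \<bullet>c f m = x \<bullet>c f m + y \<bullet>c f m" for m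
    using x y f by (simp add: add_scalar_prod_distrib[of _ k])
  have "(x + y) \<bullet>c (x + y) = (x \<bullet>c x + y \<bullet>c x) + (x \<bullet>c y + y \<bullet>c y)"
    using x y by (simp add: cscalar_prod_coords[of _ k] sum.distrib algebra_simps)
  moreover have "Re (y \<bullet>c x) = Re (x \<bullet>c y)"
    using cscalar_prod_cnj[OF x y] by simp
  ultimately have "Re ((x + y) \<bullet>c (x + y)) = Re (x \<bullet>c x) + Re (y \<bullet>c y) + 2 * Re (x \<bullet>c y)"
    by simp
  then show ?thesis
    using sq[of "x + y"] sq[OF x] sq[OF y] x y
    by (simp add: lin expand sum.distrib sum_distrib_left[symmetric])
qed

lemma parseval_polarised:
  assumes P: "parseval_frame n k f" and x: "x \<in> carrier_vec k" and y: "y \<in> carrier_vec k"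
  shows "(\<Sum>m\<in>UNIV. (x \<bullet>c f m) * cnj (y \<bullet>c f m)) = x \<bullet>c y"
proof (rule complex_eqI)
  show "Re (\<Sum>m\<in>UNIV. (x \<bullet>c f m) * cnj (y \<bullet>c f m)) = Re (x \<bullet>c y)"
    using parseval_polarised_Re[OF P x y] by (simp only: Re_sum)
  have f: "f m \<in> carrier_vec k" for m
    using P by (simp add: parseval_frame_def)
  have iy: "\<i> \<cdot>\<^sub>v y \<in> carrier_vec k"
    using y by simp
  have "(\<i> \<cdot>\<^sub>v y) \<bullet>c f m = \<i> * (y \<bullet>c f m)" for m
    using y f[of m] by simp
  moreover have "x \<bullet>c (\<i> \<cdot>\<^sub>v y) = - \<i> * (x \<bullet>c y)"
    using y by (simp add: cscalar_prod_coords[of _ k] sum_distrib_left algebra_simps sum_negf)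
  ultimately show "Im (\<Sum>m\<in>UNIV. (x \<bullet>c f m) * cnj (y \<bullet>c f m)) = Im (x \<bullet>c y)"
    using parseval_polarised_Re[OF P x iy] by (simp add: algebra_simps)
qed

lemma hermitian_idempotent_diag:
  fixes P :: "'i::finite \<Rightarrow> 'i \<Rightarrow> complex"
  assumes herm: "\<And>i j. P i j = cnj (P j i)"
    and idem: "\<And>i j. (\<Sum>m\<in>UNIV. P i m * P m j) = P i j"
  shows "P i i = complex_of_real (\<Sum>m\<in>UNIV. (cmod (P i m))\<^sup>2)"
proof -
  have "P i m * P m i = complex_of_real ((cmod (P i m))\<^sup>2)" for m
    by (subst herm[of m i]) (simp add: complex_norm_square[symmetric])
  then show ?thesis
    using idem[of i i] by simp
qed

text \<open>An orthogonal projection of trace \<open>k\<close> is a sum of \<open>k\<close> rank-one projections. If \<open>k > 0\<close>, some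
  diagonal entry \<open>P c c\<close> is nonzero; column \<open>c\<close> of \<open>P\<close> lies in the range of \<open>P\<close> and has squared norm
  \<open>P c c\<close>. Subtracting the projection onto that column leaves an orthogonal projection of trace
  \<open>k - 1\<close>. If \<open>k = 0\<close>, the trace is the sum of all squared moduli of entries, so \<open>P = 0\<close>.\<close>

lemma hermitian_idempotent_factor:
  fixes P :: "'i::finite \<Rightarrow> 'i \<Rightarrow> complex"
  assumes "\<And>i j. P i j = cnj (P j i)"
    and "\<And>i j. (\<Sum>m\<in>UNIV. P i m * P m j) = P i j"
    and "(\<Sum>i\<in>UNIV. P i i) = of_nat k"
  shows "\<exists>F :: 'i \<Rightarrow> nat \<Rightarrow> complex. \<forall>i j. P i j = (\<Sum>a<k. F j a * cnj (F i a))"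
  using assms
proof (induction k arbitrary: P)
  case 0
  have "(\<Sum>i\<in>UNIV. \<Sum>m\<in>UNIV. (cmod (P i m))\<^sup>2) = 0"
    using 0(3) hermitian_idempotent_diag[of P, OF 0(1,2)]
    by (simp flip: of_real_sum)
  then have "P i m = 0" for i m
    by (simp add: sum_nonneg_eq_0_iff sum_nonneg)
  then show ?case
    by simp
next
  case (Suc k)
  note herm = Suc.prems(1) and idem = Suc.prems(2)
  have "\<exists>c. P c c \<noteq> 0"
  proof (rule ccontr)
    assume "\<not> ?thesis"
    then have "(\<Sum>i\<in>UNIV. P i i) = 0"
      by simp
    then show False
      using Suc.prems(3) of_nat_neq_0[of k, where 'a = complex] by simp
  qed
  then obtain c where c: "P c c \<noteq> 0"
    by blast
  define r where "r = (\<Sum>m\<in>UNIV. (cmod (P c m))\<^sup>2)"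
  have Pcc: "P c c = complex_of_real r"
    unfolding r_def by (rule hermitian_idempotent_diag[of P, OF herm idem])
  have "r \<ge> 0"
    unfolding r_def by (rule sum_nonneg) simp
  then have r: "r > 0"
    using c Pcc by (cases "r = 0") auto
  define R where "R = (\<lambda>i j. P i j - P i c * P c j / r)"
  have Rherm: "R i j = cnj (R j i)" for i j
    using herm[of i j] herm[of i c] herm[of c j] by (simp add: R_def)
  have Ridem: "(\<Sum>m\<in>UNIV. R i m * R m j) = R i j" for i j
  proof -
    have "(\<Sum>m\<in>UNIV. R i m * R m j) =
        (\<Sum>m\<in>UNIV. P i m * P m j) - (\<Sum>m\<in>UNIV. P i m * P m c) * P c j / r
        - P i c * (\<Sum>m\<in>UNIV. P c m * P m j) / r
        + P i c * (\<Sum>m\<in>UNIV. P c m * P m c) * P c j / (r * r)"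
      by (simp add: R_def algebra_simps sum.distrib sum_subtractf sum_distrib_left
          sum_distrib_right sum_divide_distrib)
    also have "\<dots> = P i j - P i c * P c j / r - P i c * P c j / r
        + P i c * complex_of_real r * P c j / (r * r)"
      by (simp only: idem Pcc)
    also have "\<dots> = R i j"
      using r by (simp add: R_def)
    finally show ?thesis .
  qed
  have "(\<Sum>i\<in>UNIV. R i i) = (\<Sum>i\<in>UNIV. P i i) - (\<Sum>i\<in>UNIV. P c i * P i c) / r"
    by (simp add: R_def sum_subtractf sum_divide_distrib mult.commute)
  also have "\<dots> = of_nat k"
    using r by (simp add: Suc.prems(3) idem Pcc)
  finally obtain F where F: "\<And>i j. R i j = (\<Sum>a<k. F j a * cnj (F i a))"
    using Suc.IH[of R, OF Rherm Ridem] by blast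
  define F' where "F' = (\<lambda>j a. if a < k then F j a else P c j / sqrt r)"
  have "P i j = (\<Sum>a<Suc k. F' j a * cnj (F' i a))" for i j
  proof -
    have "complex_of_real (sqrt r) * complex_of_real (sqrt r) = r"
      using r by (simp flip: of_real_mult)
    moreover have "cnj (P c i) = P i c"
      using herm[of i c] by simp
    ultimately have "P c j / sqrt r * cnj (P c i / sqrt r) = P i c * P c j / r"
      by simp
    then have "(\<Sum>a<Suc k. F' j a * cnj (F' i a)) = R i j + P i c * P c j / r"
      by (simp add: F'_def F)
    then show ?thesis
      by (simp add: R_def)
  qed
  then show ?case
    by blast
qed

text \<open>The number of columns forces orthonormality: for the Gram matrix \<open>H\<close> of the \<open>k\<close> columns,
  \<open>tr H = tr P = k\<close> and \<open>tr H\<^sup>2 = tr P\<^sup>2 = k\<close>, hence the squared Frobenius norm of \<open>H - I\<close> is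
  \<open>k - 2k + k = 0\<close>.\<close>

lemma factor_columns_orthonormal:
  fixes P :: "'i::finite \<Rightarrow> 'i \<Rightarrow> complex" and F :: "'i \<Rightarrow> nat \<Rightarrow> complex"
  assumes F: "\<And>i j. P i j = (\<Sum>a<k. F j a * cnj (F i a))"
    and idem: "\<And>i j. (\<Sum>m\<in>UNIV. P i m * P m j) = P i j"
    and tr: "(\<Sum>i\<in>UNIV. P i i) = of_nat k"
    and "a < k" "b < k"
  shows "(\<Sum>i\<in>UNIV. F i a * cnj (F i b)) = (if a = b then 1 else 0)"
proof -
  define H where "H = (\<lambda>a b. \<Sum>i\<in>UNIV. F i a * cnj (F i b))"
  have tr1: "(\<Sum>a<k. H a a) = of_nat k"
    unfolding tr[symmetric] H_def F by (rule sum.swap)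
  have "(\<Sum>a<k. \<Sum>b<k. H a b * cnj (H a b)) =
      (\<Sum>a<k. \<Sum>b<k. \<Sum>i\<in>UNIV. \<Sum>j\<in>UNIV. F i a * cnj (F i b) * (F j b * cnj (F j a)))"
    by (simp add: H_def sum_product algebra_simps)
  also have "\<dots> = (\<Sum>i\<in>UNIV. \<Sum>j\<in>UNIV. \<Sum>a<k. \<Sum>b<k. F i a * cnj (F i b) * (F j b * cnj (F j a)))"
    by (simp only: sum.swap[of _ "{..<k}" "UNIV :: 'i set"])
  also have "\<dots> = (\<Sum>i\<in>UNIV. \<Sum>j\<in>UNIV. P j i * P i j)"
    by (simp add: F sum_product algebra_simps)
  also have "\<dots> = of_nat k"
    by (subst sum.swap) (simp add: idem tr)
  finally have tr2: "(\<Sum>a<k. \<Sum>b<k. H a b * cnj (H a b)) = of_nat k" .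
  have "complex_of_real (\<Sum>a<k. \<Sum>b<k. (cmod (H a b - (if a = b then 1 else 0)))\<^sup>2) = 
     (\<Sum>a<k. \<Sum>b<k. (H a b - (if a = b then 1 else 0)) * cnj (H a b - (if a = b then 1 else 0)))"
    by (simp only: of_real_sum of_real_power of_real_cmod_square)
  also have "\<dots> = (\<Sum>a<k. \<Sum>b<k. H a b * cnj (H a b) - (if a = b then H a a + cnj (H a a) - 1 else 0))"
    by (intro sum.cong refl) (auto simp: algebra_simps)
  also have "\<dots> = of_nat k - (\<Sum>a<k. H a a) - cnj (\<Sum>a<k. H a a) + of_nat k"
    by (simp add: sum_subtractf tr2 sum.distrib)
  also have "\<dots> = 0"
    by (simp add: tr1)
  finally have "(\<Sum>a<k. \<Sum>b<k. (cmod (H a b - (if a = b then 1 else 0)))\<^sup>2) = 0"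
    by (simp only: of_real_eq_0_iff)
  then have "H a b = (if a = b then 1 else 0)"
    using \<open>a < k\<close> \<open>b < k\<close> by (simp add: sum_nonneg_eq_0_iff sum_nonneg split: if_splits)
  then show ?thesis
    by (simp add: H_def)
qed

text \<open>The rows of a factor with orthonormal columns form the frame.\<close>

lemma idempotent_is_parseval_gram:
  fixes P :: "'i::finite \<Rightarrow> 'i \<Rightarrow> complex"
  assumes herm: "\<And>i j. P i j = cnj (P j i)"
    and idem: "\<And>i j. (\<Sum>m\<in>UNIV. P i m * P m j) = P i j"
    and tr: "(\<Sum>i\<in>UNIV. P i i) = of_nat k"
  shows "\<exists>f :: 'i \<Rightarrow> complex Matrix.vec. parseval_frame CARD('i) k f \<and> (\<forall>i j. f j \<bullet>c f i = P i j)"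
proof -
  obtain F :: "'i \<Rightarrow> nat \<Rightarrow> complex" where F: "\<And>i j. P i j = (\<Sum>a<k. F j a * cnj (F i a))"
    using hermitian_idempotent_factor[of P k, OF herm idem tr] by blast
  define f where "f = (\<lambda>i. Matrix.vec k (F i))"
  have f: "f i \<in> carrier_vec k" for i
    by (simp add: f_def)
  have gram: "f j \<bullet>c f i = P i j" for i j
    by (simp add: cscalar_prod_coords[OF f] F) (simp add: f_def)
  have "(\<Sum>j\<in>UNIV. (cmod (x \<bullet>c f j))\<^sup>2) = (cvec_norm x)\<^sup>2" if x: "x \<in> carrier_vec k" for x
  proof -
    let ?x = "vec_index x"
    have "complex_of_real (\<Sum>j\<in>UNIV. (cmod (x \<bullet>c f j))\<^sup>2) =
        (\<Sum>j\<in>UNIV. (\<Sum>a<k. ?x a * cnj (F j a)) * (\<Sum>b<k. cnj (?x b) * F j b))"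
      by (simp add: of_real_cmod_square cscalar_prod_coords[OF f]) (simp add: f_def)
    also have "\<dots> = (\<Sum>j\<in>UNIV. \<Sum>a<k. \<Sum>b<k. ?x a * cnj (?x b) * (F j b * cnj (F j a)))"
      unfolding sum_product by (simp add: ac_simps)
    also have "\<dots> = (\<Sum>a<k. \<Sum>b<k. \<Sum>j\<in>UNIV. ?x a * cnj (?x b) * (F j b * cnj (F j a)))"
      by (simp only: sum.swap[of _ "{..<k}" "UNIV :: 'i set"])
    also have "\<dots> = (\<Sum>a<k. \<Sum>b<k. ?x a * cnj (?x b) * (if b = a then 1 else 0))"
      by (intro sum.cong refl)
        (simp add: sum_distrib_left[symmetric]
          factor_columns_orthonormal[where P = P and F = F, OF F idem tr])
    also have "\<dots> = x \<bullet>c x"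
      unfolding cscalar_prod_coords[OF x]
      by (intro sum.cong refl) (simp add: if_distrib[of "\<lambda>z. _ * z"] cong: if_cong)
    also have "\<dots> = complex_of_real ((cvec_norm x)\<^sup>2)"
      by (rule cscalar_prod_self[OF x])
    finally show ?thesis
      by (simp only: of_real_eq_iff)
  qed
  then have "parseval_frame CARD('i) k f"
    using f by (simp add: parseval_frame_def)
  then show ?thesis
    using gram by blast
qed

section \<open>Signature matrices as solutions of a quadratic equation\<close>

lemma equiangular_of_gram:
  fixes f :: "'i::finite \<Rightarrow> complex Matrix.vec"
  assumes f: "\<And>i. f i \<in> carrier_vec k"
    and diag: "\<And>i. f i \<bullet>c f i = complex_of_real r" and "r > 0"
    and off: "\<And>i j. i \<noteq> j \<Longrightarrow> cmod (f i \<bullet>c f j) = c"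
  shows "equiangular k f"
proof -
  have norm: "cvec_norm (f i) = sqrt r" for i
    by (simp add: cvec_norm_def diag)
  have "f i \<noteq> 0\<^sub>v k" for i
  proof
    assume "f i = 0\<^sub>v k"
    then have "f i \<bullet>c f i = 0"
      by (simp add: cscalar_prod_coords[of _ k])
    then show False
      using diag[of i] \<open>r > 0\<close> by simp
  qed
  moreover have "cmod (normalized (f i) \<bullet>c normalized (f j)) = c / r" if "i \<noteq> j" for i j
  proof -
    have "normalized (f i) \<bullet>c normalized (f j) =
        complex_of_real (1 / sqrt r) * complex_of_real (1 / sqrt r) * (f i \<bullet>c f j)"
      using f[of i] f[of j]
      by (simp add: normalized_def norm cscalar_prod_coords[of _ k] sum_distrib_left ac_simps)
    also have "complex_of_real (1 / sqrt r) * complex_of_real (1 / sqrt r) = complex_of_real (1 / r)"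
      using \<open>r > 0\<close> by (simp flip: of_real_mult)
    finally show ?thesis
      using \<open>r > 0\<close> off[OF that] by (simp add: norm_mult norm_divide)
  qed
  ultimately show ?thesis
    unfolding equiangular_def by blast
qed

lemma frame_const_square:
  assumes "1 \<le> k" "k < n"
  shows "frame_const n k > 0"
    and "(frame_const n k)\<^sup>2 * (real n - 1) = real k * (real n - real k) / (real n)\<^sup>2"
proof -
  have "real n - 1 > 0" "real k > 0" "real n - real k > 0"
    using assms by linarith+
  then have pos: "real k * (real n - real k) / ((real n)\<^sup>2 * (real n - 1)) > 0"
    by simp
  then show "frame_const n k > 0"
    unfolding frame_const_def by simp
  show "(frame_const n k)\<^sup>2 * (real n - 1) = real k * (real n - real k) / (real n)\<^sup>2"
    unfolding frame_const_def real_sqrt_pow2[OF less_imp_le[OF pos]]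
    using \<open>real n - 1 > 0\<close> by simp
qed

text \<open>The Gram matrix \<open>P = r I + c Q\<close> with \<open>r = k/n\<close> is idempotent iff
  \<open>c\<^sup>2 Q\<^sup>2 = (r - r\<^sup>2) I + c (1 - 2r) Q\<close>. On the diagonal \<open>Q\<^sup>2\<close> equals \<open>n - 1\<close> because the entries of
  \<open>Q\<close> off the diagonal are unimodular, and the frame constant \<open>c\<close> satisfies
  \<open>c\<^sup>2 (n - 1) = r - r\<^sup>2\<close>. So only the entries off the diagonal impose a condition.\<close>

lemma signature_matrix_iff:
  fixes Q :: "'i::finite sq_matrix"
  assumes card: "CARD('i) = n" and k: "1 \<le> k" "k < n"
    and sa: "self_adjoint Q" and diag: "\<And>i. Q $ i $ i = 0"
    and unit: "\<And>i j. i \<noteq> j \<Longrightarrow> cmod (Q $ i $ j) = 1"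
  shows "signature_matrix n k Q \<longleftrightarrow>
    (\<forall>i j. i \<noteq> j \<longrightarrow> (\<Sum>m\<in>UNIV. Q $ i $ m * Q $ m $ j) =
       complex_of_real ((real n - 2 * real k) / (real n * frame_const n k)) * Q $ i $ j)"
    (is "_ \<longleftrightarrow> ?quadratic")
proof -
  define q where "q = (\<lambda>i j. Q $ i $ j)"
  define c where "c = frame_const n k"
  define r where "r = real k / real n"
  define P where "P = (\<lambda>i j. (if i = j then complex_of_real r else 0) + complex_of_real c * q i j)"
  define QQ where "QQ = (\<lambda>i j. \<Sum>m\<in>UNIV. q i m * q m j)"
  have c: "c > 0" and c2: "c\<^sup>2 * (real n - 1) = real k * (real n - real k) / (real n)\<^sup>2"
    using frame_const_square[OF k] by (simp_all add: c_def)
  have r: "r > 0"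
    using k by (simp add: r_def)
  have qsa: "q i j = cnj (q j i)" for i j
    using sa unfolding self_adjoint_def q_def by blast
  have qdiag: "q i i = 0" for i
    using diag by (simp add: q_def)
  have qunit: "cmod (q i j) = 1" if "i \<noteq> j" for i j
    using unit[OF that] by (simp add: q_def)
  have herm: "P i j = cnj (P j i)" for i j
    using qsa[of i j] by (simp add: P_def)
  have PP: "(\<Sum>m\<in>UNIV. P i m * P m j) =
      (if i = j then complex_of_real (r\<^sup>2) else 0)
      + complex_of_real (2 * r * c) * q i j + complex_of_real (c\<^sup>2) * QQ i j" for i j
  proof -
    have "P i m * P m j =
        (if m = i then (if i = j then complex_of_real (r\<^sup>2) else 0) + r * c * q i j else 0)
        + (if m = j then r * c * q i j else 0) + c\<^sup>2 * (q i m * q m j)" for m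
      by (auto simp: P_def algebra_simps power2_eq_square)
    then show ?thesis
      by (simp add: sum.distrib QQ_def sum_distrib_left)
  qed
  have QQdiag: "QQ i i = complex_of_real (real n - 1)" for i
  proof -
    have "q i m * q m i = (if m = i then 0 else 1)" for m
      using qunit[of i m] qdiag of_real_cmod_square[of "q i m"] by (subst qsa[of m i]) auto
    then have "QQ i i = (\<Sum>m\<in>UNIV. 1 - (if m = i then 1 else 0))"
      unfolding QQ_def by (intro sum.cong) auto
    also have "\<dots> = complex_of_real (real n - 1)"
      by (simp add: sum_subtractf card)
    finally show ?thesis .
  qed
  have idem_diag: "(\<Sum>m\<in>UNIV. P i m * P m i) = P i i" for i
  proof -
    have "r\<^sup>2 + c\<^sup>2 * (real n - 1) = r"
      unfolding c2 using k by (simp add: r_def field_simps power2_eq_square)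
    then have "complex_of_real (r\<^sup>2 + c\<^sup>2 * (real n - 1)) = complex_of_real r"
      by (rule arg_cong)
    then show ?thesis
      unfolding PP QQdiag by (simp add: qdiag P_def)
  qed
  have idem_off: "(\<Sum>m\<in>UNIV. P i m * P m j) = P i j \<longleftrightarrow>
      QQ i j = complex_of_real ((real n - 2 * real k) / (real n * c)) * q i j" if "i \<noteq> j" for i j
  proof -
    have "(real n - 2 * real k) / (real n * c) = (1 - 2 * r) / c"
      using k by (simp add: r_def field_simps)
    then have "QQ i j = complex_of_real ((real n - 2 * real k) / (real n * c)) * q i j \<longleftrightarrow>
        QQ i j = complex_of_real ((1 - 2 * r) / c) * q i j"
      by (simp only:)
    also have "\<dots> \<longleftrightarrow> c * QQ i j = (1 - 2 * r) * q i j"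
      using c by (simp add: field_simps)
    also have "\<dots> \<longleftrightarrow> c * (c * QQ i j) = c * ((1 - 2 * r) * q i j)"
      using c by simp
    also have "\<dots> \<longleftrightarrow> (\<Sum>m\<in>UNIV. P i m * P m j) = P i j"
      unfolding PP using that by (auto simp: P_def algebra_simps power2_eq_square)
    finally show ?thesis
      by blast
  qed
  have quadratic: "?quadratic \<longleftrightarrow> (\<forall>i j. (\<Sum>m\<in>UNIV. P i m * P m j) = P i j)"
  proof (intro iffI allI)
    fix i j
    assume Q2: ?quadratic
    show "(\<Sum>m\<in>UNIV. P i m * P m j) = P i j"
    proof (cases "i = j")
      case True
      then show ?thesis
        using idem_diag by simp
    next
      case False
      then show ?thesis
        unfolding idem_off[OF False] using Q2 unfolding QQ_def q_def c_def by blast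
    qed
  next
    fix i j
    assume "\<forall>i j. (\<Sum>m\<in>UNIV. P i m * P m j) = P i j"
    then have "i \<noteq> j \<longrightarrow> QQ i j = complex_of_real ((real n - 2 * real k) / (real n * c)) * q i j"
      using idem_off by blast
    then show "i \<noteq> j \<longrightarrow> (\<Sum>m\<in>UNIV. Q $ i $ m * Q $ m $ j) =
        complex_of_real ((real n - 2 * real k) / (real n * frame_const n k)) * Q $ i $ j"
      unfolding QQ_def q_def c_def .
  qed
  have gram: "gram_matrix f =
      (real k / real n) *\<^sub>R Finite_Cartesian_Product.mat 1 + frame_const n k *\<^sub>R Q
      \<longleftrightarrow> (\<forall>i j. f j \<bullet>c f i = P i j)" for f
    by (auto simp: gram_matrix_def Finite_Cartesian_Product.vec_eq_iff P_def q_def r_def c_def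
        Finite_Cartesian_Product.mat_def scaleR_conv_of_real[where 'a = complex])
  have frame: "?quadratic \<longleftrightarrow> (\<exists>f :: 'i \<Rightarrow> complex Matrix.vec.
      equiangular_frame n k f \<and> (\<forall>i j. f j \<bullet>c f i = P i j))"
    unfolding quadratic
  proof
    assume idem: "\<forall>i j. (\<Sum>m\<in>UNIV. P i m * P m j) = P i j"
    have "(\<Sum>i\<in>UNIV. P i i) = of_nat k"
      using k by (simp add: P_def qdiag card r_def)
    then obtain f :: "'i \<Rightarrow> complex Matrix.vec"
      where f: "parseval_frame n k f" and G: "\<And>i j. f j \<bullet>c f i = P i j"
      using idempotent_is_parseval_gram[of P k, OF herm] idem card by blast
    have "equiangular k f"
    proof (rule equiangular_of_gram[where r = r and c = c])
      show "f i \<in> carrier_vec k" for i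
        using f by (simp add: parseval_frame_def)
      show "f i \<bullet>c f i = complex_of_real r" for i
        by (simp add: G P_def qdiag)
      show "cmod (f i \<bullet>c f j) = c" if "i \<noteq> j" for i j
        using c qunit[of j i] that by (simp add: G P_def norm_mult)
    qed (rule r)
    then show "\<exists>f :: 'i \<Rightarrow> complex Matrix.vec.
        equiangular_frame n k f \<and> (\<forall>i j. f j \<bullet>c f i = P i j)"
      using f G unfolding equiangular_frame_def by blast
  next
    assume "\<exists>f :: 'i \<Rightarrow> complex Matrix.vec.
        equiangular_frame n k f \<and> (\<forall>i j. f j \<bullet>c f i = P i j)"
    then obtain f :: "'i \<Rightarrow> complex Matrix.vec"
      where f: "parseval_frame n k f" and G: "\<And>i j. f j \<bullet>c f i = P i j"
      unfolding equiangular_frame_def by blast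
    have fk: "f m \<in> carrier_vec k" for m
      using f by (simp add: parseval_frame_def)
    have "(\<Sum>m\<in>UNIV. P i m * P m j) = P i j" for i j
    proof -
      have "P i m = cnj (f i \<bullet>c f m)" for m
        using herm[of i m] G[of i m] by metis
      then show ?thesis
        using parseval_polarised[OF f fk fk, of j i] by (simp add: G mult.commute)
    qed
    then show "\<forall>i j. (\<Sum>m\<in>UNIV. P i m * P m j) = P i j"
      by blast
  qed
  show ?thesis
  proof
    assume "signature_matrix n k Q"
    then show ?quadratic
      unfolding signature_matrix_def gram frame by (elim conjE)
  next
    assume ?quadratic
    then show "signature_matrix n k Q"
      unfolding signature_matrix_def gram frame using k sa diag unit by (intro conjI allI impI)
  qed
qed

section \<open>The sign function of a difference set\<close>

text \<open>The matrix of the signature set \<open>D - {0}\<close> has this function at \<open>i - j\<close> as its entry in row \<open>i\<close>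
  and column \<open>j\<close>.\<close>

definition nonzero_sign :: "'g::group_add set \<Rightarrow> 'g \<Rightarrow> real" where
  "nonzero_sign D x = (if x = 0 then 0 else if x \<in> D then 1 else - 1)"

text \<open>The coefficient of the point mass at \<open>0\<close> that corrects \<open>2 1\<^sub>D - 1\<close> to vanish at \<open>0\<close>. It is the
  only trace that the two cases \<open>0 \<notin> D\<close> and \<open>0 \<in> D\<close> leave in the argument.\<close>

definition zero_sign :: "'g::group_add set \<Rightarrow> real" where
  "zero_sign D = (if 0 \<in> D then - 1 else 1)"

lemma nonzero_sign_eq:
  "nonzero_sign D x = 2 * indicator D x + (if x = 0 then zero_sign D else 0) - 1"
  by (simp add: nonzero_sign_def zero_sign_def indicator_def)

lemma reversible_iff: "reversible D \<longleftrightarrow> (\<forall>x. - x \<in> D \<longleftrightarrow> x \<in> D)"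
  unfolding reversible_def by (metis (no_types, lifting) image_iff minus_minus subsetI subset_antisym)

lemma reversible_iff_nonzero_sign_even:
  "reversible D \<longleftrightarrow> (\<forall>x. nonzero_sign D (- x) = nonzero_sign D x)"
  unfolding reversible_iff
proof (intro all_cong1)
  show "(- x \<in> D \<longleftrightarrow> x \<in> D) \<longleftrightarrow> nonzero_sign D (- x) = nonzero_sign D x" for x
    by (cases "x = 0") (auto simp: nonzero_sign_def)
qed

lemma sum_left_regular_entry:
  "(\<Sum>g\<in>S. left_regular g) $ i $ j = (if i - j \<in> S then 1 else 0)"
proof -
  have "(\<Sum>g\<in>S. left_regular g) $ i $ j = (\<Sum>g\<in>S. if g = i - j then 1 else 0)"
    unfolding sum_component left_regular_def by (intro sum.cong refl) (auto simp: eq_diff_eq)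
  then show ?thesis
    by simp
qed

lemma signature_set_punctured:
  "signature_set n k (D - {0}) \<longleftrightarrow>
     signature_matrix n k (\<chi> i j. complex_of_real (nonzero_sign D (i - j)))"
proof -
  have "(\<Sum>g\<in>D - {0}. left_regular g) - (\<Sum>h\<in>UNIV - {0} - (D - {0}). left_regular h)
      = (\<chi> i j. complex_of_real (nonzero_sign D (i - j)))"
    by (auto simp: Finite_Cartesian_Product.vec_eq_iff sum_left_regular_entry nonzero_sign_def
        simp del: sum_component)
  then show ?thesis
    by (auto simp: signature_set_def Let_def)
qed

lemma sum_translate:
  fixes h :: "'g::{group_add,finite} \<Rightarrow> 'b::comm_monoid_add"
  shows "(\<Sum>y\<in>UNIV. h (g + y)) = sum h UNIV" and "(\<Sum>y\<in>UNIV. h (y + g)) = sum h UNIV"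
    and "(\<Sum>y\<in>UNIV. h (g - y)) = sum h UNIV"
proof -
  show "(\<Sum>y\<in>UNIV. h (g + y)) = sum h UNIV"
    by (rule sum.reindex_bij_witness[of _ "\<lambda>y. - g + y" "\<lambda>y. g + y"]) (auto simp flip: add.assoc)
  show "(\<Sum>y\<in>UNIV. h (y + g)) = sum h UNIV"
    by (rule sum.reindex_bij_witness[of _ "\<lambda>y. y - g" "\<lambda>y. y + g"]) (auto simp: add.assoc)
  show "(\<Sum>y\<in>UNIV. h (g - y)) = sum h UNIV"
    by (rule sum.reindex_bij_witness[of _ "\<lambda>y. - y + g" "\<lambda>y. g - y"])
      (auto simp: minus_diff_eq diff_conv_add_uminus minus_add add.assoc simp del: add_uminus_conv_diff)
qed

lemma sum_indicator_eq_card: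
  fixes D :: "'g::finite set"
  shows "(\<Sum>y\<in>UNIV. indicator D y :: real) = real (card D)"
  by (simp add: indicator_def sum.If_cases)

text \<open>The pairs in \<open>D\<close> with difference \<open>g\<close> are the pairs \<open>(g + y, y)\<close>.\<close>

lemma difference_set_correlation:
  fixes D :: "'g::{group_add,finite} set"
  assumes "difference_set n k l D"
  shows "(\<Sum>y\<in>UNIV. indicator D (g + y) * indicator D y) = (if g = 0 then real k else real l)"
proof -
  have "(\<Sum>y\<in>UNIV. indicator D (g + y) * indicator D y :: real)
      = (\<Sum>y\<in>UNIV. indicator {y. g + y \<in> D \<and> y \<in> D} y)"
    by (intro sum.cong refl) (auto simp: indicator_def)
  also have "\<dots> = real (card {y. g + y \<in> D \<and> y \<in> D})"
    by (rule sum_indicator_eq_card)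
  also have "\<dots> = (if g = 0 then real k else real l)"
  proof (cases "g = 0")
    case True
    then show ?thesis
      using assms by (simp add: difference_set_def)
  next
    case False
    have "bij_betw (\<lambda>y. (g + y, y)) {y. g + y \<in> D \<and> y \<in> D} {(x, y). x \<in> D \<and> y \<in> D \<and> g = x - y}"
      by (rule bij_betw_byWitness[of _ snd]) (auto simp: eq_diff_eq)
    then show ?thesis
      using assms False by (simp add: difference_set_def bij_betw_same_card)
  qed
  finally show ?thesis .
qed

text \<open>Summing the correlation over all \<open>g\<close> counts all pairs of elements of \<open>D\<close>.\<close>

lemma difference_set_count:
  fixes D :: "'g::{group_add,finite} set"
  assumes D: "difference_set n k l D"
  shows "real l * (real n - 1) = real k * (real k - 1)"
proof -
  have n: "CARD('g) = n" and k: "card D = k"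
    using D by (simp_all add: difference_set_def)
  have "(\<Sum>g\<in>UNIV. \<Sum>y\<in>UNIV. indicator D (g + y) * indicator D y)
      = (\<Sum>y\<in>UNIV. (\<Sum>g\<in>UNIV. indicator D (g + y)) * indicator D y :: real)"
    by (subst sum.swap) (simp add: sum_distrib_right)
  also have "\<dots> = real k * real k"
    by (simp only: sum_translate sum_indicator_eq_card k flip: sum_distrib_left)
  finally have "(\<Sum>g\<in>(UNIV :: 'g set). real l + (if g = 0 then real k - real l else 0)) = real k * real k"
    unfolding difference_set_correlation[OF D]
    by (simp add: if_distrib cong: if_cong)
  then show ?thesis
    by (simp add: sum.distrib n algebra_simps)
qed

text \<open>Expanding both factors by \<open>nonzero_sign_eq\<close>, the point masses contribute \<open>2 s\<close> times the
  indicator of \<open>D\<close> at \<open>g\<close> and at \<open>- g\<close>. Reversibility makes these two equal, so that together with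
  the constant terms they add up to a multiple of the sign of \<open>g\<close>.\<close>

lemma nonzero_sign_correlation:
  fixes D :: "'g::{group_add,finite} set"
  assumes D: "difference_set n k l D" and rev: "reversible D" and "g \<noteq> 0"
  shows "(\<Sum>y\<in>UNIV. nonzero_sign D (g + y) * nonzero_sign D y) =
     real n - 4 * (real k - real l) + 2 * zero_sign D * nonzero_sign D g"
proof -
  define s where "s = zero_sign D"
  define I where "I = (\<lambda>x. indicator D x :: real)"
  have n: "CARD('g) = n" and k: "card D = k"
    using D by (simp_all add: difference_set_def)
  have Ik: "sum I UNIV = real k"
    unfolding I_def by (simp only: sum_indicator_eq_card k)
  have corr: "(\<Sum>y\<in>UNIV. I (g + y) * I y) = real l"
    using difference_set_correlation[OF D, of g] \<open>g \<noteq> 0\<close> by (simp add: I_def)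
  have Irev: "I (- g) = I g"
    using rev by (simp add: I_def indicator_def reversible_iff)
  \<comment> \<open>The point masses at \<open>y = 0\<close> and \<open>y = - g\<close> do not meet because \<open>g \<noteq> 0\<close>.\<close>
  have "nonzero_sign D (g + y) * nonzero_sign D y =
      4 * (I (g + y) * I y) - 2 * I (g + y) - 2 * I y + 1
      + (if y = 0 then 2 * s * I g - s else 0) + (if y = - g then 2 * s * I (- g) - s else 0)" for y
    using \<open>g \<noteq> 0\<close>
    by (auto simp: nonzero_sign_eq I_def s_def add_eq_0_iff algebra_simps)
  then have "(\<Sum>y\<in>UNIV. nonzero_sign D (g + y) * nonzero_sign D y) =
      4 * real l - 2 * real k - 2 * real k + real n + (2 * s * I g - s) + (2 * s * I (- g) - s)"
    by (simp add: sum.distrib sum_subtractf corr Ik n sum_translate(1)[of I] flip: sum_distrib_left)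
  also have "\<dots> = real n - 4 * (real k - real l) + 2 * s * nonzero_sign D g"
    using \<open>g \<noteq> 0\<close> by (simp add: nonzero_sign_eq Irev flip: I_def) (simp add: I_def algebra_simps)
  finally show ?thesis
    by (simp add: s_def)
qed

section \<open>Signature sets from difference sets\<close>

text \<open>For even \<open>q\<close>, substituting \<open>y = j - m\<close> in \<open>\<Sum>m. q(i - m) q(m - j)\<close> gives the autocorrelation of
  \<open>q\<close> at \<open>i - j\<close>, also in a noncommutative group. Thus the quadratic equation becomes a condition
  on the nonzero elements of the group.\<close>

lemma signature_set_iff_correlation:
  fixes D :: "'g::{group_add,finite} set"
  assumes D: "difference_set n k l D"
  shows "signature_set n k (D - {0}) \<longleftrightarrow> reversible D \<and> 1 \<le> k \<and> k < n \<and>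
    (\<forall>g. g \<noteq> 0 \<longrightarrow> real n - 4 * (real k - real l) + 2 * zero_sign D * nonzero_sign D g
       = (real n - 2 * real k) / (real n * frame_const n k) * nonzero_sign D g)"
proof -
  define q where "q = nonzero_sign D"
  define Q :: "'g sq_matrix" where "Q = (\<chi> i j. complex_of_real (q (i - j)))"
  define \<mu> where "\<mu> = (real n - 2 * real k) / (real n * frame_const n k)"
  have n: "CARD('g) = n"
    using D by (simp add: difference_set_def)
  have Q: "Q $ i $ j = complex_of_real (q (i - j))" for i j
    by (simp add: Q_def)
  have diag: "Q $ i $ i = 0" for i
    by (simp add: Q q_def nonzero_sign_def)
  have unit: "cmod (Q $ i $ j) = 1" if "i \<noteq> j" for i j
    using that by (simp add: Q q_def nonzero_sign_def)
  have sa: "self_adjoint Q \<longleftrightarrow> reversible D"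
  proof
    assume "self_adjoint Q"
    then have "q (0 - x) = q (x - 0)" for x
      unfolding self_adjoint_def Q complex_cnj_complex_of_real of_real_eq_iff by blast
    then show "reversible D"
      by (simp add: reversible_iff_nonzero_sign_even q_def)
  next
    assume "reversible D"
    then have "q (i - j) = q (j - i)" for i j
      unfolding reversible_iff_nonzero_sign_even q_def by (metis minus_diff_eq)
    then show "self_adjoint Q"
      by (simp add: self_adjoint_def Q)
  qed
  have "signature_matrix n k Q \<longleftrightarrow>
      (\<forall>g. g \<noteq> 0 \<longrightarrow> real n - 4 * (real k - real l) + 2 * zero_sign D * q g = \<mu> * q g)"
    if rev: "reversible D" and k: "1 \<le> k" "k < n"
  proof -
    have square: "(\<Sum>m\<in>UNIV. Q $ i $ m * Q $ m $ j) =
        complex_of_real (\<Sum>y\<in>UNIV. q (i - j + y) * q y)" for i j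
    proof -
      have "q (i - m) * q (m - j) = q (i - j + (j - m)) * q (j - m)" for m
      proof -
        have "i - j + (j - m) = i - m"
          by (simp add: add_diff_eq)
        moreover have "q (m - j) = q (j - m)"
          using rev unfolding reversible_iff_nonzero_sign_even q_def by (metis minus_diff_eq)
        ultimately show ?thesis
          by simp
      qed
      then have "(\<Sum>m\<in>UNIV. Q $ i $ m * Q $ m $ j) =
          complex_of_real (\<Sum>m\<in>UNIV. q (i - j + (j - m)) * q (j - m))"
        unfolding Q of_real_mult[symmetric] by simp
      then show ?thesis
        by (simp only: sum_translate(3)[of "\<lambda>y. q (i - j + y) * q y" j])
    qed
    have "signature_matrix n k Q \<longleftrightarrow> (\<forall>i j. i \<noteq> j \<longrightarrow>
        (\<Sum>m\<in>UNIV. Q $ i $ m * Q $ m $ j) = complex_of_real \<mu> * Q $ i $ j)"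
      unfolding \<mu>_def using sa rev by (intro signature_matrix_iff[OF n k _ diag unit]) auto
    also have "\<dots> \<longleftrightarrow>
        (\<forall>i j. i \<noteq> j \<longrightarrow> (\<Sum>y\<in>UNIV. q (i - j + y) * q y) = \<mu> * q (i - j))"
      unfolding square unfolding Q of_real_mult[symmetric] of_real_eq_iff by (rule refl)
    also have "\<dots> \<longleftrightarrow> (\<forall>g. g \<noteq> 0 \<longrightarrow> (\<Sum>y\<in>UNIV. q (g + y) * q y) = \<mu> * q g)"
      (is "?pairs \<longleftrightarrow> ?elements")
    proof
      assume pairs: ?pairs
      have "(\<Sum>y\<in>UNIV. q (g + y) * q y) = \<mu> * q g" if "g \<noteq> 0" for g
        using pairs[rule_format, of g 0] that by simp
      then show ?elements
        by blast
    next
      assume ?elements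
      then show ?pairs
        by simp
    qed
    also have "\<dots> \<longleftrightarrow>
        (\<forall>g. g \<noteq> 0 \<longrightarrow> real n - 4 * (real k - real l) + 2 * zero_sign D * q g = \<mu> * q g)"
      using nonzero_sign_correlation[OF D rev] by (simp add: q_def)
    finally show ?thesis .
  qed
  moreover have "signature_matrix n k Q \<Longrightarrow> reversible D \<and> 1 \<le> k \<and> k < n"
    unfolding signature_matrix_def sa by (elim conjE) (intro conjI)
  ultimately have "signature_matrix n k Q \<longleftrightarrow> reversible D \<and> 1 \<le> k \<and> k < n \<and>
      (\<forall>g. g \<noteq> 0 \<longrightarrow> real n - 4 * (real k - real l) + 2 * zero_sign D * q g = \<mu> * q g)"
    by (metis (no_types))
  then show ?thesis
    unfolding signature_set_punctured Q_def q_def \<mu>_def .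
qed

lemma n_times_frame_const:
  assumes "n \<ge> 1"
  shows "real n * frame_const n k = sqrt (real k * (real n - real k) / (real n - 1))"
proof -
  have "real n * frame_const n k = sqrt ((real n)\<^sup>2 * (real k * (real n - real k) / ((real n)\<^sup>2 * (real n - 1))))"
    unfolding real_sqrt_mult[of "(real n)\<^sup>2"] by (simp add: frame_const_def)
  also have "(real n)\<^sup>2 * (real k * (real n - real k) / ((real n)\<^sup>2 * (real n - 1)))
      = real k * (real n - real k) / (real n - 1)"
    using assms by simp
  finally show ?thesis .
qed

text \<open>If \<open>(n - 2k)\<^sup>2 = n\<close>, then \<open>4 k (n - k) = n (n - 1)\<close>, so \<open>n\<close> times the frame constant is
  \<open>sqrt n / 2\<close>.\<close>

lemma sign_condition_iff:
  fixes n k :: nat and s :: real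
  assumes "n \<ge> 3" "1 \<le> k" "k < n" and s: "s = 1 \<or> s = - 1"
    and square: "(real n - 2 * real k)\<^sup>2 = real n"
  shows "(real n - 2 * real k) / (real n * frame_const n k) = 2 * s
    \<longleftrightarrow> real n - 2 * real k = s * sqrt (real n)"
proof -
  have "4 * (real k * (real n - real k)) = real n * (real n - 1)"
    using square by (simp add: power2_eq_square algebra_simps)
  then have "real k * (real n - real k) / (real n - 1) = real n / 4"
    using \<open>n \<ge> 3\<close> by (simp add: field_simps)
  then have "real n * frame_const n k = sqrt (real n / 4)"
    using n_times_frame_const[of n k] \<open>n \<ge> 3\<close> by simp
  also have "\<dots> = sqrt (real n) / 2"
    by (simp add: real_sqrt_divide)
  finally have nc: "real n * frame_const n k = sqrt (real n) / 2" .
  show ?thesis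
    unfolding nc using \<open>n \<ge> 3\<close> by (auto simp: field_simps)
qed

text \<open>The common form of both parts. Forward, the sign function either takes both signs, and adding
  and subtracting the two resulting equations separates \<open>A\<close> from \<open>\<mu>\<close>, or it is constant off \<open>0\<close>,
  which is impossible for \<open>n \<ge> 3\<close>. Backward, \<open>n - 2k = s sqrt n\<close> gives \<open>A = 0\<close> and \<open>\<mu> = 2s\<close>, and
  \<open>sqrt n < n\<close> gives \<open>1 \<le> k < n\<close>.\<close>

theorem punctured_difference_set_signature_iff:
  fixes D :: "'g::{group_add,finite} set"
  assumes D: "difference_set n k l D" and "n \<ge> 3"
  shows "signature_set n k (D - {0}) \<longleftrightarrow>
    reversible D \<and> real n - 2 * real k = zero_sign D * sqrt (real n)"
proof -
  define s where "s = zero_sign D"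
  define A where "A = real n - 4 * (real k - real l)"
  define \<mu> where "\<mu> = (real n - 2 * real k) / (real n * frame_const n k)"
  have n: "CARD('g) = n" and k: "card D = k"
    using D by (simp_all add: difference_set_def)
  have s: "s = 1 \<or> s = - 1"
    by (simp add: s_def zero_sign_def)
  have count: "real l * (real n - 1) = real k * (real k - 1)"
    by (rule difference_set_count[OF D])
  \<comment> \<open>Expand \<open>(n - 1) A\<close> and replace \<open>l (n - 1)\<close> by \<open>k (k - 1)\<close>.\<close>
  then have "(real n - 2 * real k)\<^sup>2 - real n = (real n - 1) * A"
    by (simp add: A_def power2_eq_square algebra_simps)
  then have A0: "A = 0 \<longleftrightarrow> (real n - 2 * real k)\<^sup>2 = real n"
    using \<open>n \<ge> 3\<close> by auto
  have forward: "A = 0 \<and> \<mu> = 2 * s"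
    if k1: "1 \<le> k" "k < n"
      and eq: "\<And>g. g \<noteq> 0 \<Longrightarrow> A + 2 * s * nonzero_sign D g = \<mu> * nonzero_sign D g"
  proof -
    have "(UNIV :: 'g set) \<noteq> {0}"
    proof
      assume "(UNIV :: 'g set) = {0}"
      then have "CARD('g) = card {0 :: 'g}"
        by (rule arg_cong)
      then show False
        using n \<open>n \<ge> 3\<close> by simp
    qed
    then obtain g\<^sub>0 :: 'g where g0: "g\<^sub>0 \<noteq> 0"
      by auto
    \<comment> \<open>In both degenerate cases \<open>k (n - k) = n - 1\<close>, hence \<open>\<mu> = n - 2k\<close>, which is \<open>\<plusminus>(n - 2)\<close>;
      comparing with \<open>A\<close> leaves only \<open>n = 2\<close>.\<close>
    have edge: "real n * frame_const n k = 1" if "k = 1 \<or> k = n - 1"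
    proof -
      have "real k * (real n - real k) = real n - 1"
        using that k1 by (auto simp: of_nat_diff)
      then show ?thesis
        using n_times_frame_const[of n k] \<open>n \<ge> 3\<close> by simp
    qed
    consider (full) "\<And>g. g \<noteq> 0 \<Longrightarrow> g \<in> D" | (empty) "\<And>g. g \<noteq> 0 \<Longrightarrow> g \<notin> D"
      | (mixed) g h where "g \<noteq> 0" "g \<in> D" "h \<noteq> 0" "h \<notin> D"
      by metis
    then show ?thesis
    proof cases
      case full
      have "0 \<notin> D"
      proof
        assume "0 \<in> D"
        then have "D = UNIV"
          using full by (metis UNIV_eq_I)
        then show False
          using n k k1 by simp
      qed
      then have "D = UNIV - {0}"
        using full by blast
      then have kn: "k = n - 1"
        using n k by (simp add: card_Diff_singleton)
      then have "real l * (real n - 1) = (real n - 2) * (real n - 1)"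
        using count k1 by (simp add: of_nat_diff algebra_simps)
      then have "real l = real n - 2"
        using \<open>n \<ge> 3\<close> by simp
      moreover have "A + 2 = \<mu>"
        using eq[OF g0] full[OF g0] g0 \<open>0 \<notin> D\<close> by (simp add: nonzero_sign_def s_def zero_sign_def)
      ultimately show ?thesis
        using edge kn k1 \<open>n \<ge> 3\<close> by (simp add: \<mu>_def A_def of_nat_diff)
    next
      case empty
      have "D = {0}"
      proof -
        have "D \<noteq> {}"
          using k k1 by auto
        moreover have "x = 0" if "x \<in> D" for x
          using empty[of x] that by (cases "x = 0") simp_all
        ultimately show ?thesis
          by blast
      qed
      then have k: "k = 1" and "s = - 1"
        using k by (auto simp: s_def zero_sign_def)
      moreover have "l = 0"
        using count k \<open>n \<ge> 3\<close> by simp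
      moreover have "A - 2 * s = - \<mu>"
        using eq[OF g0] empty[OF g0] g0 by (simp add: nonzero_sign_def)
      ultimately show ?thesis
        using edge \<open>n \<ge> 3\<close> by (simp add: \<mu>_def A_def)
    next
      case mixed
      then show ?thesis
        using eq[of g] eq[of h] by (simp add: nonzero_sign_def)
    qed
  qed
  have "1 \<le> k \<and> k < n \<and>
      (\<forall>g. g \<noteq> 0 \<longrightarrow> A + 2 * s * nonzero_sign D g = \<mu> * nonzero_sign D g)
      \<longleftrightarrow> real n - 2 * real k = s * sqrt (real n)" (is "?L \<longleftrightarrow> ?R")
  proof
    assume L: ?L
    then have k1: "1 \<le> k" "k < n"
      by simp_all
    have A: "A = 0" and \<mu>: "\<mu> = 2 * s"
      using forward[OF k1] L by simp_all
    show ?R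
      using sign_condition_iff[OF \<open>n \<ge> 3\<close> k1 s] A A0 \<mu> by (simp only: \<mu>_def)
  next
    assume R: ?R
    have "sqrt (real n) < real n"
      using \<open>n \<ge> 3\<close> by (intro real_less_lsqrt) (simp_all add: power2_eq_square)
    moreover have "0 \<le> sqrt (real n)"
      by simp
    moreover have "real n - 2 * real k = sqrt (real n) \<or> real n - 2 * real k = - sqrt (real n)"
      using R s by auto
    ultimately have "0 < real k" "real k < real n"
      by linarith+
    then have k1: "1 \<le> k" "k < n"
      by simp_all
    have square: "(real n - 2 * real k)\<^sup>2 = real n"
      using s unfolding R by (auto simp: power_mult_distrib)
    then have "A = 0"
      by (simp only: A0)
    moreover have "\<mu> = 2 * s"
      using sign_condition_iff[OF \<open>n \<ge> 3\<close> k1 s square] R by (simp only: \<mu>_def)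
    ultimately show ?L
      using k1 by simp
  qed
  then show ?thesis
    unfolding signature_set_iff_correlation[OF D] A_def \<mu>_def s_def by (simp only:)
qed

theorem theorem4p8:
  fixes D :: "'g::{group_add,finite} set" and n k l :: nat
  assumes "difference_set n k l D" and "n \<ge> 3"
  shows "(0 \<notin> D \<longrightarrow>
            (signature_set n k D \<longleftrightarrow>
               reversible D \<and> real k = (real n - sqrt (real n)) / 2)) \<and>
         (0 \<in> D \<longrightarrow>
            (signature_set n k (D - {0}) \<longleftrightarrow>
               reversible D \<and> real k = (real n + sqrt (real n)) / 2))"
proof (intro conjI impI)
  assume "0 \<notin> D"
  then have D: "D - {0} = D" and s: "zero_sign D = 1"
    by (simp_all add: zero_sign_def)
  have "real n - 2 * real k = 1 * sqrt (real n) \<longleftrightarrow> real k = (real n - sqrt (real n)) / 2"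
    by auto
  then show "signature_set n k D \<longleftrightarrow>
      reversible D \<and> real k = (real n - sqrt (real n)) / 2"
    using punctured_difference_set_signature_iff[OF assms] by (simp only: D s)
next
  assume "0 \<in> D"
  then have s: "zero_sign D = - 1"
    by (simp add: zero_sign_def)
  have "real n - 2 * real k = - 1 * sqrt (real n) \<longleftrightarrow> real k = (real n + sqrt (real n)) / 2"
    by auto
  then show "signature_set n k (D - {0}) \<longleftrightarrow>
      reversible D \<and> real k = (real n + sqrt (real n)) / 2"
    using punctured_difference_set_signature_iff[OF assms] by (simp only: s)
qed

end
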